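(* Let $m$ be a complex number and let $x$ be an indeterminate. The sequence of Eulerian-Dowling polynomials $\mathcal{A}_m(n,x)=\sum_{k=0}^n k!\,W_m(n,k)(x-1)^{n-k}$, $n\ge 0$, is the moment sequence of a family of orthogonal polynomials over the field $\mathbb{C}(x)$.
   Context: The Whitney numbers of the second kind of Dowling lattices are $W_m(n,k)=\sum_{i=k}^n\binom{n}{i}m^{i-k}S(i,k)$ (with $0^0=1$), where $S(i,k)$ are the Stirling numbers of the second kind; for $m\ne 0$ this is equivalent to $\sum_{n\ge 0} W_m(n,k)\frac{z^n}{n!}=\frac{e^z}{m^k k!}(e^{mz}-1)^k$, and $W_0(n,k)=\binom{n}{k}$. Orthogonality is meant in the formal (algebraic) sense. Let $K=\mathbb{C}(x)$. A family of orthogonal polynomials over $K$ is a sequence $(P_n(z))_{n\ge 0}$ of monic polynomials in $K[z]$ with $\deg P_n=n$ for which there is a $K$-linear functional $\mathcal{L}:K[z]\to K$ with $\mathcal{L}(1)=1$, $\mathcal{L}(P_iP_j)=0$ for all $i\ne j$, and $\mathcal{L}(P_n^2)\neq 0$ for all $n$. Its moment sequence is $(\mathcal{L}(z^n))_{n\ge 0}$. *)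

theory Defs
  imports
    "HOL-Computational_Algebra.Computational_Algebra"
    "HOL-Combinatorics.Stirling"
begin

text \<open>Here \<open>Stirling\<close> is the library's function for the Stirling numbers of the second kind.\<close>

definition dowling_whitney :: "complex \<Rightarrow> nat \<Rightarrow> nat \<Rightarrow> complex" where
  "dowling_whitney m n k =
     (\<Sum>i = k..n. of_nat (n choose i) * m ^ (i - k) * of_nat (Stirling i k))"

text \<open>The indeterminate \<open>x\<close> is \<open>[:0, 1:]\<close>, so that \<open>[:- 1, 1:]\<close> is \<open>x - 1\<close>.\<close>

definition eulerian_dowling :: "complex \<Rightarrow> nat \<Rightarrow> complex poly" where
  "eulerian_dowling m n =
     (\<Sum>k = 0..n. smult (fact k * dowling_whitney m n k) ([:- 1, 1:] ^ (n - k)))"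

definition orthogonal_polynomials_wrt ::
  "('a::field poly \<Rightarrow> 'a) \<Rightarrow> (nat \<Rightarrow> 'a poly) \<Rightarrow> bool" where
  "orthogonal_polynomials_wrt L P \<longleftrightarrow>
     (\<forall>n. lead_coeff (P n) = 1 \<and> degree (P n) = n) \<and>
     Vector_Spaces.linear smult (*) L \<and>
     L 1 = 1 \<and>
     (\<forall>i j. i \<noteq> j \<longrightarrow> L (P i * P j) = 0) \<and>
     (\<forall>n. L ((P n)\<^sup>2) \<noteq> 0)"

definition orthogonal_moment_sequence :: "(nat \<Rightarrow> 'a::field) \<Rightarrow> bool" where
  "orthogonal_moment_sequence \<mu> \<longleftrightarrow>
     (\<exists>P L. orthogonal_polynomials_wrt L P \<and> (\<forall>n. \<mu> n = L (monom 1 n)))"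

end

theory Submission
  imports Defs
begin

text \<open>
  Put \<open>u = x - 1\<close> and \<open>a = m u\<close>. The exponential generating function of the moments is
  \<open>e\<^bsup>uz\<^esup> / (1 - w)\<close> with \<open>w = (e\<^bsup>az\<^esup> - 1) / a\<close> (read as \<open>z\<close> when \<open>m = 0\<close>), which is of Meixner type: the recurrence is
  \<open>P\<^bsub>n+1\<^esub> = (z - b\<^sub>n) P\<^sub>n - \<lambda>\<^sub>n P\<^bsub>n-1\<^esub>\<close> with \<open>b\<^sub>n = u + 1 + n (a + 2)\<close> and
  \<open>\<lambda>\<^sub>n = n\<^sup>2 (1 + a)\<close>, and \<open>\<lambda>\<^sub>n \<noteq> 0\<close> because \<open>1 + m (x - 1)\<close> equals \<open>1\<close> at \<open>x = 1\<close>.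
  The coefficients of \<open>z\<^sup>n = \<Sum>\<^sub>k \<alpha>(n,k) P\<^sub>k\<close> have the generating function
  \<open>e\<^bsup>uz\<^esup> w\<^sup>k (1 - w)\<^bsup>-k-1\<^esup> / k!\<close> in \<open>n\<close>; expanding it in powers of \<open>w\<close> gives
  \<open>\<alpha>(n,k) = \<Sum>\<^sub>j (j choose k)\<^sup>2 (j - k)! W\<^sub>m(n,j) u\<^bsup>n-j\<^esup>\<close>, and the recurrence in \<open>n\<close> that
  characterises these coefficients follows from the triangular recurrence of the Whitney numbers.
\<close>

subsection \<open>Orthogonality from a Stieltjes matrix\<close>

fun three_term_poly :: "(nat \<Rightarrow> 'a::field) \<Rightarrow> (nat \<Rightarrow> 'a) \<Rightarrow> nat \<Rightarrow> 'a poly" where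
  "three_term_poly b c 0 = 1"
| "three_term_poly b c (Suc 0) = [:- b 0, 1:]"
| "three_term_poly b c (Suc (Suc n)) =
     [:- b (Suc n), 1:] * three_term_poly b c (Suc n) - smult (c (Suc n)) (three_term_poly b c n)"

lemma three_term_poly_monic:
  "degree (three_term_poly b c n) = n \<and> coeff (three_term_poly b c n) n = 1"
proof (induction b c n rule: three_term_poly.induct)
  case (3 b c n)
  let ?p = "[:- b (Suc n), 1:] * three_term_poly b c (Suc n)"
  let ?q = "smult (c (Suc n)) (three_term_poly b c n)"
  have "three_term_poly b c (Suc n) \<noteq> 0"
    using "3.IH"(1) by auto
  then have deg: "degree ?p = Suc (Suc n)"
    using "3.IH"(1) by (subst degree_mult_eq) auto
  have lead: "lead_coeff ?p = 1"
    using "3.IH"(1) by (subst lead_coeff_mult) simp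
  have "degree ?q < degree ?p"
    using "3.IH"(2) deg degree_smult_le[of "c (Suc n)" "three_term_poly b c n"] by linarith
  then have "degree (?p - ?q) = degree ?p" "coeff ?q (degree ?p) = 0"
    by (simp_all only: degree_add_eq_left degree_minus diff_conv_add_uminus coeff_eq_0)
  then show ?case
    using deg lead by (simp only: three_term_poly.simps coeff_diff) simp
qed simp_all

definition moment_functional :: "(nat \<Rightarrow> 'a::field) \<Rightarrow> 'a poly \<Rightarrow> 'a" where
  "moment_functional \<mu> p = (\<Sum>i\<le>degree p. coeff p i * \<mu> i)"

text \<open>Padding with zero coefficients frees the bound from \<open>degree p\<close>, so
  polynomials of different degrees can be compared in one sum.\<close>

lemma moment_functional_eq:
  assumes "degree p \<le> N"
  shows "moment_functional \<mu> p = (\<Sum>i\<le>N. coeff p i * \<mu> i)"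
  unfolding moment_functional_def
  by (rule sum.mono_neutral_left) (use assms in \<open>auto simp: coeff_eq_0\<close>)

lemma moment_functional_add:
  "moment_functional \<mu> (p + q) = moment_functional \<mu> p + moment_functional \<mu> q"
proof -
  let ?N = "max (degree p) (degree q)"
  show ?thesis
    by (simp add: moment_functional_eq[of _ ?N] degree_add_le sum.distrib algebra_simps)
qed

lemma moment_functional_smult:
  "moment_functional \<mu> (smult r p) = r * moment_functional \<mu> p"
  by (simp add: moment_functional_eq[of _ "degree p"] degree_smult_le sum_distrib_left
      algebra_simps)

lemma moment_functional_diff:
  "moment_functional \<mu> (p - q) = moment_functional \<mu> p - moment_functional \<mu> q"
  using moment_functional_add[of \<mu> p "smult (-1) q"] moment_functional_smult[of \<mu> "-1" q]
  by simp

lemma moment_functional_monom: "moment_functional \<mu> (monom 1 n) = \<mu> n"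
  by (simp add: moment_functional_eq[of _ n] degree_monom_le coeff_monom if_distrib if_distribR
      sum.delta' cong: if_cong)

lemma moment_functional_pCons_0:
  "moment_functional \<mu> (pCons 0 p) = moment_functional (\<lambda>n. \<mu> (Suc n)) p"
  by (simp add: moment_functional_eq[of "pCons 0 p" "Suc (degree p)"] moment_functional_eq[of _ "degree p"]
      degree_pCons_le sum.atMost_Suc_shift del: sum.atMost_Suc)

lemma moment_functional_linear_combination:
  "moment_functional (\<lambda>n. r * \<mu> n + s * \<nu> n) p = r * moment_functional \<mu> p + s * moment_functional \<nu> p"
  by (simp add: moment_functional_def sum.distrib sum_distrib_left algebra_simps)

lemma linear_factor_mult: "[:- r, 1:] * p = pCons 0 p - smult r p"
  for r :: "'a::comm_ring_1"
  by simp

text \<open>Think of \<open>\<alpha> n k\<close> as the coefficient of P_k in z^n. Multiplying by z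
  with z P_k = P_(k+1) + b_k P_k + c_k P_(k-1) and collecting P_k gives the two row
  recurrences.\<close>

locale stieltjes_matrix =
  fixes \<alpha> :: "nat \<Rightarrow> nat \<Rightarrow> 'a::field" and b c :: "nat \<Rightarrow> 'a"
  assumes zero: "\<alpha> 0 k = (if k = 0 then 1 else 0)"
    and Suc_0: "\<alpha> (Suc n) 0 = b 0 * \<alpha> n 0 + c 1 * \<alpha> n 1"
    and Suc_Suc: "\<alpha> (Suc n) (Suc k) =
      \<alpha> n k + b (Suc k) * \<alpha> n (Suc k) + c (Suc (Suc k)) * \<alpha> n (Suc (Suc k))"
    and nonzero: "c (Suc k) \<noteq> 0"
begin

abbreviation "P \<equiv> three_term_poly b c"

definition functional :: "nat \<Rightarrow> 'a poly \<Rightarrow> 'a" where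
  "functional k = moment_functional (\<lambda>n. \<alpha> n k)"

lemma functional_diff: "functional k (p - q) = functional k p - functional k q"
  by (simp add: functional_def moment_functional_diff)

lemma functional_smult: "functional k (smult r p) = r * functional k p"
  by (simp add: functional_def moment_functional_smult)

lemma functional_one: "functional k 1 = (if k = 0 then 1 else 0)"
  by (simp add: functional_def moment_functional_def zero)

lemma functional_pCons_0_at_0:
  "functional 0 (pCons 0 p) = b 0 * functional 0 p + c 1 * functional 1 p"
  by (simp only: functional_def moment_functional_pCons_0 Suc_0
      moment_functional_linear_combination)

lemma functional_pCons_0_at_Suc:
  "functional (Suc k) (pCons 0 p) =
     functional k p + b (Suc k) * functional (Suc k) p
       + c (Suc (Suc k)) * functional (Suc (Suc k)) p"
  using moment_functional_linear_combination[of 1 "\<lambda>n. \<alpha> n k + b (Suc k) * \<alpha> n (Suc k)"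
      "c (Suc (Suc k))" "\<lambda>n. \<alpha> n (Suc (Suc k))" p]
    moment_functional_linear_combination[of 1 "\<lambda>n. \<alpha> n k" "b (Suc k)" "\<lambda>n. \<alpha> n (Suc k)" p]
  by (simp add: functional_def moment_functional_pCons_0 Suc_Suc)

lemmas functional_simps =
  functional_diff functional_smult functional_one functional_pCons_0_at_0 functional_pCons_0_at_Suc

text \<open>The functionals form the dual basis of \<open>P\<close>: multiplication by z acts on
  them by the transpose of the three-term recurrence, so all terms cancel except the shifted
  delta.\<close>

lemma functional_P: "functional k (P n) = (if k = n then 1 else 0)"
proof (induction n arbitrary: k rule: induct_nat_012)
  case 0
  show ?case by (simp add: functional_simps)
next
  case 1
  have "P (Suc 0) = pCons 0 1 - smult (b 0) 1"
    by simp
  then show ?case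
    by (cases k) (simp_all only: functional_simps, auto)
next
  case (ge2 n)
  have "P (Suc (Suc n)) = pCons 0 (P (Suc n)) - smult (b (Suc n)) (P (Suc n)) - smult (c (Suc n)) (P n)"
    by (simp only: three_term_poly.simps linear_factor_mult)
  then show ?case
    by (cases k) (simp_all only: functional_simps ge2, auto)
qed

text \<open>The recurrence of \<open>P\<close> moves the factor z onto \<open>p\<close>, and the
  rule for \<open>functional (Suc n)\<close> at z p then leaves only the next functional, times the
  next \<open>c\<close>. Keeping \<open>p\<close> arbitrary makes the induction go through;
  \<open>p = P i\<close> gives orthogonality and the norms c_1 ... c_n.\<close>

lemma functional_0_mult_P:
  "functional 0 (p * P n) = (\<Prod>i=1..n. c i) * functional n p"
proof (induction n arbitrary: p rule: induct_nat_012)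
  case 0
  show ?case by simp
next
  case 1
  have "p * P (Suc 0) = pCons 0 p - smult (b 0) p"
    by simp
  then show ?case
    by (simp only: functional_simps) simp
next
  case (ge2 n)
  have "p * P (Suc (Suc n)) =
      pCons 0 p * P (Suc n) - smult (b (Suc n)) (p * P (Suc n)) - smult (c (Suc n)) (p * P n)"
    by (simp only: three_term_poly.simps) (simp add: algebra_simps)
  then show ?case
    by (simp only: functional_simps ge2) (simp add: algebra_simps)
qed

lemma orthogonal: "orthogonal_polynomials_wrt (functional 0) P"
proof -
  have "functional 0 (P i * P j) = (if i = j then \<Prod>i=1..j. c i else 0)" for i j
    by (simp add: functional_0_mult_P functional_P)
  moreover have "c i \<noteq> 0" if "Suc 0 \<le> i" for i
    using that nonzero[of "i - 1"] by simp
  moreover have "Vector_Spaces.linear smult (*) (functional 0)"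
    by unfold_locales
      (simp_all add: functional_def moment_functional_add moment_functional_smult smult_add_left
        smult_add_right algebra_simps)
  ultimately show ?thesis
    unfolding orthogonal_polynomials_wrt_def
    by (simp add: three_term_poly_monic functional_one power2_eq_square)
qed

lemma moments: "orthogonal_moment_sequence (\<lambda>n. \<alpha> n 0)"
  unfolding orthogonal_moment_sequence_def
  using orthogonal by (metis functional_def moment_functional_monom)

end

subsection \<open>Whitney numbers of Dowling lattices\<close>

text \<open>Pascal's rule for binomial transforms. Whitney numbers are such transforms of m^(i-k)
  S(i,k), so the Stirling recurrence carries over.\<close>

lemma sum_binomial_Suc:
  fixes f :: "nat \<Rightarrow> 'a::comm_semiring_1"
  shows "(\<Sum>i\<le>Suc n. of_nat (Suc n choose i) * f i) = (\<Sum>i\<le>n. of_nat (n choose i) * (f i + f (Suc i)))"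
proof -
  have "(\<Sum>i\<le>Suc n. of_nat (Suc n choose i) * f i) =
      f 0 + (\<Sum>i\<le>n. of_nat (n choose Suc i) * f (Suc i)) + (\<Sum>i\<le>n. of_nat (n choose i) * f (Suc i))"
    by (simp add: sum.atMost_Suc_shift sum.distrib algebra_simps del: sum.atMost_Suc)
  also have "f 0 + (\<Sum>i\<le>n. of_nat (n choose Suc i) * f (Suc i)) = (\<Sum>i\<le>Suc n. of_nat (n choose i) * f i)"
    by (subst sum.atMost_Suc_shift) simp
  finally show ?thesis
    by (simp add: sum.distrib binomial_eq_0 algebra_simps)
qed

lemma dowling_whitney_eq:
  "dowling_whitney m n k = (\<Sum>i\<le>n. of_nat (n choose i) * (m ^ (i - k) * of_nat (Stirling i k)))"
  unfolding dowling_whitney_def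
  by (rule sum.mono_neutral_cong_left) (auto simp: not_le)

lemma dowling_whitney_less: "n < k \<Longrightarrow> dowling_whitney m n k = 0"
  by (simp add: dowling_whitney_def)

lemma dowling_whitney_0_0: "dowling_whitney m 0 0 = 1"
  by (simp add: dowling_whitney_def)

lemma dowling_whitney_Suc_0: "dowling_whitney m (Suc n) 0 = dowling_whitney m n 0"
  unfolding dowling_whitney_eq sum_binomial_Suc by simp

lemma dowling_whitney_Suc_Suc:
  "dowling_whitney m (Suc n) (Suc k) =
     dowling_whitney m n k + (1 + m * of_nat (Suc k)) * dowling_whitney m n (Suc k)"
proof -
  have "m ^ (Suc i - Suc k) * of_nat (Stirling (Suc i) (Suc k)) =
      m ^ (i - k) * of_nat (Stirling i k)
        + m * of_nat (Suc k) * (m ^ (i - Suc k) * of_nat (Stirling i (Suc k)))" for i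
  \<comment> \<open>For i <= k truncated subtraction spoils the exponent of m, but there S(i,k+1) =
    0.\<close>
  proof (cases "i < Suc k")
    case False
    then have "i - k = Suc (i - Suc k)" by simp
    then show ?thesis by (simp add: algebra_simps)
  qed simp
  then show ?thesis
    unfolding dowling_whitney_eq sum_binomial_Suc
    by (simp add: sum.distrib sum_distrib_left distrib_left algebra_simps)
qed

definition homogeneous_whitney :: "complex \<Rightarrow> nat \<Rightarrow> nat \<Rightarrow> complex poly" where
  "homogeneous_whitney m n j = smult (dowling_whitney m n j) ([:- 1, 1:] ^ (n - j))"

lemma homogeneous_whitney_Suc_0:
  "homogeneous_whitney m (Suc n) 0 = [:- 1, 1:] * homogeneous_whitney m n 0"
  by (simp add: homogeneous_whitney_def dowling_whitney_Suc_0)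

lemma homogeneous_whitney_Suc_Suc:
  "homogeneous_whitney m (Suc n) (Suc j) = homogeneous_whitney m n j
     + [:- 1, 1:] * (1 + [:m:] * of_nat (Suc j)) * homogeneous_whitney m n (Suc j)"
proof (cases "n < Suc j")
  case True
  then show ?thesis
    by (simp add: homogeneous_whitney_def dowling_whitney_Suc_Suc dowling_whitney_less)
next
  case False
  then have "n - j = Suc (n - Suc j)" by simp
  moreover have "1 + [:m:] * of_nat (Suc j) = [:1 + m * of_nat (Suc j):]"
    by (simp add: of_nat_poly one_pCons)
  moreover have "u * [:r:] * smult s q = smult (r * s) (u * q)" for u q :: "complex poly" and r s
    by (simp add: mult.commute)
  ultimately show ?thesis
    unfolding homogeneous_whitney_def dowling_whitney_Suc_Suc diff_Suc_Suc
    by (simp only: power_Suc smult_add_left)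
qed

text \<open>Summation by parts moves the step from n to n+1 onto the weights \<open>f\<close>. Row
  recurrences of the matrix thus reduce to identities between weights, free of n.\<close>

lemma homogeneous_whitney_sum_Suc:
  "(\<Sum>j\<le>Suc n. f j * homogeneous_whitney m (Suc n) j) =
   (\<Sum>j\<le>n. (f (Suc j) + [:- 1, 1:] * (1 + [:m:] * of_nat j) * f j) * homogeneous_whitney m n j)"
proof -
  let ?g = "\<lambda>j. [:- 1, 1:] * (1 + [:m:] * of_nat j) * f j * homogeneous_whitney m n j"
  have "(\<Sum>j\<le>Suc n. f j * homogeneous_whitney m (Suc n) j) =
      ?g 0 + (\<Sum>j\<le>n. f (Suc j) * homogeneous_whitney m n j + ?g (Suc j))"
    unfolding sum.atMost_Suc_shift homogeneous_whitney_Suc_0 homogeneous_whitney_Suc_Suc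
    by (intro arg_cong2[where f = "(+)"] sum.cong refl) (simp_all only: algebra_simps, simp)
  also have "\<dots> = (\<Sum>j\<le>n. f (Suc j) * homogeneous_whitney m n j) + (\<Sum>j\<le>Suc n. ?g j)"
    unfolding sum.atMost_Suc_shift sum.distrib by (simp only: add_ac)
  \<comment> \<open>The top term vanishes because W_m(n,n+1) = 0.\<close>
  also have "(\<Sum>j\<le>Suc n. ?g j) = (\<Sum>j\<le>n. ?g j)"
    by (simp add: homogeneous_whitney_def dowling_whitney_less)
  finally show ?thesis
    by (simp only: sum.distrib distrib_right)
qed

subsection \<open>The Stieltjes matrix of the Eulerian-Dowling polynomials\<close>

text \<open>Up to sign, the coefficients of the monic Laguerre polynomials; column 0 is j!, the
  moments of the weight e^(-t).\<close>

definition laguerre_coeff :: "nat \<Rightarrow> nat \<Rightarrow> nat" where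
  "laguerre_coeff j k = (j choose k)\<^sup>2 * fact (j - k)"

lemma laguerre_coeff_Suc_0: "laguerre_coeff (Suc j) 0 = Suc j * laguerre_coeff j 0"
  by (simp add: laguerre_coeff_def)

lemma Suc_times_binomial_Suc_eq: "Suc k * (j choose Suc k) = (j - k) * (j choose k)"
  by (simp only: binomial_absorption binomial_absorb_comp)

text \<open>This is (k+1)^2 L(j,k+1) = (j-k) L(j,k), the square of the binomial absorption identity,
  written additively to avoid truncated subtraction.\<close>

lemma laguerre_coeff_shift:
  "(Suc k)\<^sup>2 * laguerre_coeff j (Suc k) + k * laguerre_coeff j k = j * laguerre_coeff j k"
proof (cases "k < j")
  case True
  then obtain i where i: "j = Suc (k + i)"
    using less_imp_Suc_add by blast
  then have diff: "j - k = Suc i" "j - Suc k = i"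
    by simp_all
  have "(Suc k)\<^sup>2 * laguerre_coeff j (Suc k) = (Suc k * (j choose Suc k))\<^sup>2 * fact i"
    unfolding laguerre_coeff_def diff power_mult_distrib by (simp only: mult.assoc)
  also have "\<dots> = Suc i * laguerre_coeff j k"
    unfolding Suc_times_binomial_Suc_eq laguerre_coeff_def diff power2_eq_square fact_Suc of_nat_id
    by (simp only: mult_ac)
  finally show ?thesis
    using i by (simp add: algebra_simps)
qed (auto simp: laguerre_coeff_def not_less le_less binomial_eq_0)

lemma laguerre_coeff_Suc_Suc:
  "laguerre_coeff (Suc j) (Suc k) = laguerre_coeff j k + (j + k + 2) * laguerre_coeff j (Suc k)"
proof (cases "k < j")
  case True
  then obtain i where i: "j = Suc (k + i)"
    using less_imp_Suc_add by blast
  then have diff: "j - k = Suc i" "j - Suc k = i"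
    by simp_all
  define X where "X = j choose k"
  define Y where "Y = j choose Suc k"
  have XY: "Suc i * X = Suc k * Y"
    using Suc_times_binomial_Suc_eq[of k j] by (simp only: diff X_def Y_def)
  have "laguerre_coeff (Suc j) (Suc k) = (X + Y)\<^sup>2 * fact (Suc i)"
    by (simp only: laguerre_coeff_def binomial_Suc_Suc diff_Suc_Suc diff X_def Y_def)
  also have "\<dots> = X\<^sup>2 * fact (Suc i) + (2 * (Suc i * X) * Y + Suc i * Y\<^sup>2) * fact i"
    by (simp add: power2_eq_square algebra_simps)
  \<comment> \<open>By \<open>XY\<close> the cross term becomes 2(k+1) Y^2, and 2(k+1) + (i+1) = j +
    k + 2.\<close>
  also have "\<dots> = X\<^sup>2 * fact (Suc i) + (j + k + 2) * (Y\<^sup>2 * fact i)"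
    unfolding XY i by (simp add: power2_eq_square algebra_simps)
  finally show ?thesis
    by (simp only: laguerre_coeff_def diff X_def Y_def)
qed (auto simp: laguerre_coeff_def not_less le_less binomial_eq_0)

definition eulerian_dowling_matrix :: "complex \<Rightarrow> nat \<Rightarrow> nat \<Rightarrow> complex poly" where
  "eulerian_dowling_matrix m n k = (\<Sum>j\<le>n. of_nat (laguerre_coeff j k) * homogeneous_whitney m n j)"

definition eulerian_dowling_diag :: "complex \<Rightarrow> nat \<Rightarrow> complex poly" where
  "eulerian_dowling_diag m k = [:- 1, 1:] + 1 + of_nat k * ([:m:] * [:- 1, 1:] + 2)"

definition eulerian_dowling_offdiag :: "complex \<Rightarrow> nat \<Rightarrow> complex poly" where
  "eulerian_dowling_offdiag m k = of_nat (k\<^sup>2) * (1 + [:m:] * [:- 1, 1:])"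

lemma eulerian_dowling_offdiag_nonzero: "eulerian_dowling_offdiag m (Suc k) \<noteq> 0"
proof
  assume "eulerian_dowling_offdiag m (Suc k) = 0"
  then have "poly (eulerian_dowling_offdiag m (Suc k)) 1 = 0"
    by simp
  then show False
    by (simp add: eulerian_dowling_offdiag_def del: of_nat_Suc)
qed

lemma eulerian_dowling_matrix_column_0: "eulerian_dowling_matrix m n 0 = eulerian_dowling m n"
  unfolding eulerian_dowling_matrix_def eulerian_dowling_def homogeneous_whitney_def
  by (intro sum.cong) (auto simp: laguerre_coeff_def of_nat_poly mult.commute)

lemma eulerian_dowling_matrix_zero: "eulerian_dowling_matrix m 0 k = (if k = 0 then 1 else 0)"
  by (simp add: eulerian_dowling_matrix_def homogeneous_whitney_def dowling_whitney_0_0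
      laguerre_coeff_def binomial_eq_0)

lemma eulerian_dowling_matrix_Suc_0:
  "eulerian_dowling_matrix m (Suc n) 0 =
     eulerian_dowling_diag m 0 * eulerian_dowling_matrix m n 0
       + eulerian_dowling_offdiag m 1 * eulerian_dowling_matrix m n 1"
proof -
  have "of_nat (laguerre_coeff (Suc j) 0)
      + U * (1 + M * of_nat j) * of_nat (laguerre_coeff j 0) =
      (U + 1 + of_nat 0 * (M * U + 2)) * of_nat (laguerre_coeff j 0)
        + of_nat (1\<^sup>2) * (1 + M * U) * of_nat (laguerre_coeff j 1)" for j and U M :: "complex poly"
  proof -
    have "of_nat (laguerre_coeff j 1) = (of_nat j * of_nat (laguerre_coeff j 0) :: complex poly)"
      using arg_cong[OF laguerre_coeff_shift[of 0 j], of "of_nat :: nat \<Rightarrow> complex poly"] by simp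
    then show ?thesis
      by (simp add: laguerre_coeff_Suc_0 algebra_simps)
  qed
  note coeff = this
  show ?thesis
    unfolding eulerian_dowling_matrix_def homogeneous_whitney_sum_Suc coeff
      eulerian_dowling_diag_def eulerian_dowling_offdiag_def
    by (simp only: sum_distrib_left sum.distrib distrib_right mult.assoc)
qed

lemma eulerian_dowling_matrix_Suc_Suc:
  "eulerian_dowling_matrix m (Suc n) (Suc k) =
     eulerian_dowling_matrix m n k
       + eulerian_dowling_diag m (Suc k) * eulerian_dowling_matrix m n (Suc k)
       + eulerian_dowling_offdiag m (Suc (Suc k)) * eulerian_dowling_matrix m n (Suc (Suc k))"
proof -
  \<comment> \<open>Compare the weights of each \<open>homogeneous_whitney m n j\<close>. The shift
    identity turns the \<open>k+2\<close> term into (1 + M U)(j-k-1) times the \<open>k+1\<close>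
    weight, which supplies the dependence on j.\<close>
  have "of_nat (laguerre_coeff (Suc j) (Suc k))
      + U * (1 + M * of_nat j) * of_nat (laguerre_coeff j (Suc k)) =
      of_nat (laguerre_coeff j k)
        + (U + 1 + of_nat (Suc k) * (M * U + 2)) * of_nat (laguerre_coeff j (Suc k))
        + of_nat ((Suc (Suc k))\<^sup>2) * (1 + M * U) * of_nat (laguerre_coeff j (Suc (Suc k)))"
    for j and U M :: "complex poly"
  proof -
    define D where "D = (of_nat (laguerre_coeff j (Suc k)) :: complex poly)"
    have "of_nat ((Suc (Suc k))\<^sup>2) * of_nat (laguerre_coeff j (Suc (Suc k)))
        + of_nat (Suc k) * D = of_nat j * D"
      unfolding D_def of_nat_mult[symmetric] of_nat_add[symmetric] laguerre_coeff_shift ..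
    then have shift: "of_nat ((Suc (Suc k))\<^sup>2) * of_nat (laguerre_coeff j (Suc (Suc k))) =
        (of_nat j - of_nat (Suc k)) * D"
      by (simp only: algebra_simps)
    have "of_nat ((Suc (Suc k))\<^sup>2) * (1 + M * U) * of_nat (laguerre_coeff j (Suc (Suc k))) =
        (1 + M * U) * ((of_nat j - of_nat (Suc k)) * D)"
      unfolding shift[symmetric] by (simp only: mult_ac)
    then show ?thesis
      unfolding laguerre_coeff_Suc_Suc of_nat_add of_nat_mult D_def[symmetric]
      by (simp only:) (simp add: algebra_simps)
  qed
  note coeff = this
  show ?thesis
    unfolding eulerian_dowling_matrix_def homogeneous_whitney_sum_Suc coeff
      eulerian_dowling_diag_def eulerian_dowling_offdiag_def
    by (simp only: sum_distrib_left sum.distrib distrib_right mult.assoc)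
qed

theorem proposition7:
  fixes m :: complex
  shows "orthogonal_moment_sequence
           (\<lambda>n. to_fract (eulerian_dowling m n) :: complex poly fract)"
proof -
  \<comment> \<open>The recurrences hold already over C[x]; the injective ring homomorphism
    \<open>to_fract\<close> carries them, and the nonvanishing of the off-diagonal entries, to
    C(x).\<close>
  interpret stieltjes_matrix "\<lambda>n k. to_fract (eulerian_dowling_matrix m n k)"
    "\<lambda>k. to_fract (eulerian_dowling_diag m k)" "\<lambda>k. to_fract (eulerian_dowling_offdiag m k)"
    by unfold_locales
      (simp_all add: eulerian_dowling_matrix_zero eulerian_dowling_matrix_Suc_0
        eulerian_dowling_matrix_Suc_Suc eulerian_dowling_offdiag_nonzero)
  show ?thesis
    using moments by (simp add: eulerian_dowling_matrix_column_0)
qed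

end
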